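(* Let $R=\{5,7,10,11,14,15,17,19,20,21,22\}$ (the integers $r$ with $0<r<23$ and Legendre symbol $\left(\frac{r}{23}\right)=-1$). Let $p$ be a prime with $p=23k+r$ for some nonnegative integer $k$ and some $r\in R$. Then the set $T(p)$ is nonempty.
   Context: For a prime $p$, $S(p)$ is the set of $j$ with $0\le j\le p-1$ such that $j\equiv m(3m-1)/2\pmod p$ for some integer $m$, and $T(p)$ is the set of $k$ with $0\le k\le p-1$ such that $k$ is larger than every element of $S(p)$. *)

theory Defs
  imports "HOL-Number_Theory.Number_Theory"
begin

text \<open>The division by 2 in the pentagonal number is exact for every integer \<open>m\<close>
  (lemma \<open>pentagonal_even\<close> below).\<close>

definition S :: "nat \<Rightarrow> int set" where
  "S p = {j. 0 \<le> j \<and> j \<le> int p - 1 \<and> (\<exists>m::int. [j = m * (3 * m - 1) div 2] (mod int p))}"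

definition T :: "nat \<Rightarrow> int set" where
  "T p = {k. 0 \<le> k \<and> k \<le> int p - 1 \<and> (\<forall>j\<in>S p. j < k)}"

definition R :: "nat set" where
  "R = {5, 7, 10, 11, 14, 15, 17, 19, 20, 21, 22}"

lemma pentagonal_even: "2 dvd m * (3 * m - 1)" for m :: int
  by (cases "even m") auto

lemma squares_mod_23:
  "(\<lambda>y. y\<^sup>2 mod 23) ` {0..<23::int} = {0, 1, 2, 3, 4, 6, 8, 9, 12, 13, 16, 18}"
proof -
  have "{0..<23::int} = set [0..22]"
    by auto
  also have "\<dots> = {0, 1, 2, 3, 4, 5, 6, 7, 8, 9, 10, 11, 12, 13, 14, 15, 16, 17, 18, 19, 20, 21, 22}"
    by (simp add: upto_rec1 del: set_upto)
  finally show ?thesis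
    by (simp add: insert_commute)
qed

lemma QuadRes_23_iff: "QuadRes 23 a \<longleftrightarrow> a mod 23 \<in> {0, 1, 2, 3, 4, 6, 8, 9, 12, 13, 16, 18}"
  for a :: int
proof -
  have "QuadRes 23 a \<longleftrightarrow> a mod 23 \<in> (\<lambda>y. y\<^sup>2 mod 23) ` {0..<23::int}"
  proof
    assume "QuadRes 23 a"
    then obtain y where "y\<^sup>2 mod 23 = a mod 23"
      by (auto simp: QuadRes_def cong_def)
    then have "a mod 23 = (y mod 23)\<^sup>2 mod 23"
      by (simp add: power_mod)
    then show "a mod 23 \<in> (\<lambda>y. y\<^sup>2 mod 23) ` {0..<23::int}"
      by (rule image_eqI) simp
  next
    assume "a mod 23 \<in> (\<lambda>y. y\<^sup>2 mod 23) ` {0..<23::int}"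
    then show "QuadRes 23 a"
      by (fastforce simp: QuadRes_def cong_def)
  qed
  then show ?thesis
    by (simp only: squares_mod_23)
qed

lemma R_eq_nonresidues: "R = {r. 0 < r \<and> r < 23 \<and> Legendre (int r) 23 = -1}"
proof (intro Set.set_eqI iffI)
  fix r
  assume "r \<in> R"
  then show "r \<in> {r. 0 < r \<and> r < 23 \<and> Legendre (int r) 23 = -1}"
    unfolding R_def by (elim insertE emptyE) (simp_all add: Legendre_def QuadRes_23_iff cong_def)
next
  fix r :: nat
  assume r: "r \<in> {r. 0 < r \<and> r < 23 \<and> Legendre (int r) 23 = -1}"
  then have "r < 23"
    by simp
  then have "r \<in> {0, 1, 2, 3, 4, 5, 6, 7, 8, 9, 10, 11, 12, 13, 14, 15, 16, 17, 18, 19, 20, 21, 22}"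
    by (auto simp: eval_nat_numeral less_Suc_eq)
  moreover have "\<not> QuadRes 23 (int r)"
    using r by (auto simp: Legendre_def split: if_splits)
  ultimately show "r \<in> R"
    unfolding R_def by (elim insertE emptyE) (simp_all add: QuadRes_23_iff)
qed

end

theory Submission
  imports Defs
begin

text \<open>The set \<open>T p\<close> is nonempty as soon as \<open>p - 1 \<notin> S p\<close>, that is, \<open>-1\<close> is not a pentagonal number
  modulo \<open>p\<close>. Completing the square, \<open>m (3 m - 1) / 2 \<equiv> -1\<close> gives \<open>(6 m - 1)\<^sup>2 \<equiv> -23\<close>, so it suffices
  that \<open>-23\<close> is a nonresidue modulo \<open>p\<close>; by quadratic reciprocity its Legendre symbol is that of \<open>p\<close>
  modulo \<open>23\<close>.\<close>

lemma abs_Legendre_le_1: "\<bar>Legendre a p\<bar> \<le> 1"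
  by (simp add: Legendre_def)

text \<open>Two such integers differ by at most 2, hence by less than \<open>p\<close>. This turns
  congruences from Euler's criterion into equalities of Legendre symbols.\<close>

lemma cong_abs_le_1_imp_eq:
  fixes x y p :: int
  assumes "[x = y] (mod p)" "\<bar>x\<bar> \<le> 1" "\<bar>y\<bar> \<le> 1" "2 < p"
  shows "x = y"
proof (rule ccontr)
  assume "x \<noteq> y"
  moreover have "p dvd x - y"
    using assms(1) by (simp add: cong_iff_dvd_diff)
  ultimately have "\<bar>p\<bar> \<le> \<bar>x - y\<bar>"
    by (intro dvd_imp_le_int) auto
  then show False
    using assms by linarith
qed

lemma Legendre_mult:
  fixes p :: nat
  assumes "prime p" "2 < p"
  shows "Legendre (a * b) p = Legendre a p * Legendre b p"
proof (rule cong_abs_le_1_imp_eq)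
  have "[Legendre a p * Legendre b p = (a * b) ^ ((p - 1) div 2)] (mod p)"
    using cong_mult[OF euler_criterion[OF assms] euler_criterion[OF assms]]
    by (simp add: power_mult_distrib)
  then show "[Legendre (a * b) p = Legendre a p * Legendre b p] (mod p)"
    using euler_criterion[OF assms, of "a * b"] cong_sym cong_trans by blast
  show "\<bar>Legendre a p * Legendre b p\<bar> \<le> 1"
    by (simp add: Legendre_def)
qed (use assms abs_Legendre_le_1 in auto)

lemma Legendre_minus_one:
  fixes p :: nat
  assumes "prime p" "2 < p"
  shows "Legendre (-1) p = (-1) ^ ((p - 1) div 2)"
  using euler_criterion[OF assms, of "-1"]
  by (rule cong_abs_le_1_imp_eq) (use assms abs_Legendre_le_1 in \<open>auto simp: power_abs\<close>)

text \<open>The reciprocity sign for \<open>p\<close> and 23 is \<open>(-1) ^ (11 * h)\<close> with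
  \<open>h = (p - 1) div 2\<close>. Since 11 is odd, it equals \<open>(-1) ^ h\<close>, which is
  exactly the symbol of -1 modulo \<open>p\<close>.\<close>

lemma Legendre_minus_23:
  fixes p :: nat
  assumes "prime p" "2 < p" "p \<noteq> 23"
  shows "Legendre (-23) p = Legendre p 23"
proof -
  define h where "h = (p - 1) div 2"
  have "\<not> p dvd 23"
    using assms primes_dvd_imp_eq[of p 23] by auto
  then have "\<not> int p dvd 23"
    using int_dvd_int_iff[of p 23] by simp
  \<comment> \<open>The symbol is nonzero, so it is its own inverse and can be moved across the
    reciprocity law.\<close>
  then have sq: "Legendre 23 p * Legendre 23 p = 1"
    by (simp add: Legendre_def cong_0_iff)
  have "Legendre p 23 * Legendre 23 p = (-1) ^ (h * 11)"
    using Quadratic_Reciprocity[of p 23] assms by (simp add: h_def)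
  also have "\<dots> = (-1) ^ h"
    by (simp add: mult.commute[of h] power_mult)
  finally have "Legendre p 23 = (-1) ^ h * Legendre 23 p"
    using sq by (metis mult.assoc mult.right_neutral)
  then show ?thesis
    using Legendre_mult[OF assms(1,2), of "-1" 23] Legendre_minus_one[OF assms(1,2)]
    by (simp add: h_def)
qed

lemma pentagonal_cong_minus_one:
  fixes m n :: int
  assumes "[m * (3 * m - 1) div 2 = -1] (mod n)"
  shows "[(6 * m - 1)\<^sup>2 = -23] (mod n)"
proof -
  obtain q where q: "m * (3 * m - 1) = 2 * q"
    using pentagonal_even by (rule dvdE)
  then have "n dvd q + 1"
    using assms by (simp add: cong_iff_dvd_diff)
  \<comment> \<open>The factor 24 completes the square:
    \<open>(6 * m - 1)\<^sup>2 = 12 * m * (3 * m - 1) + 1 = 24 * q + 1\<close>.\<close>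
  then have "n dvd 24 * (q + 1)"
    by (rule dvd_mult)
  also have "24 * (q + 1) = (6 * m - 1)\<^sup>2 - (-23)"
    using q by (simp add: power2_eq_square algebra_simps)
  finally show ?thesis
    by (simp add: cong_iff_dvd_diff)
qed

theorem theorem2:
  fixes p k r :: nat
  assumes "prime p"
    and "r \<in> R"
    and "p = 23 * k + r"
  shows "T p \<noteq> {}"
proof -
  have r: "Legendre r 23 = -1"
    using assms(2) by (auto simp: R_eq_nonresidues)
  \<comment> \<open>Every element of \<open>R\<close> is at least 5 and none is divisible by
    23.\<close>
  have "2 < p" "p \<noteq> 23"
    using assms(2,3) by (auto simp: R_def; presburger)+
  moreover have "Legendre p 23 = Legendre r 23"
    by (simp add: assms(3) Legendre_def QuadRes_23_iff cong_def)
  ultimately have "Legendre (-23) p = -1"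
    using Legendre_minus_23[OF assms(1)] r by simp
  then have nonres: "\<not> QuadRes p (-23)"
    by (auto simp: Legendre_def split: if_splits)
  have "int p - 1 \<notin> S p"
  proof
    assume "int p - 1 \<in> S p"
    then obtain m :: int where "[int p - 1 = m * (3 * m - 1) div 2] (mod p)"
      by (auto simp: S_def)
    moreover have "[int p - 1 = -1] (mod p)"
      by (simp add: cong_iff_dvd_diff)
    ultimately have "[m * (3 * m - 1) div 2 = -1] (mod p)"
      using cong_sym cong_trans by blast
    then show False
      using nonres pentagonal_cong_minus_one unfolding QuadRes_def by blast
  qed
  \<comment> \<open>Elements of \<open>S p\<close> are at most \<open>p - 1\<close> by definition,
    so excluding that value makes the bound strict.\<close>
  then have "\<forall>j\<in>S p. j < int p - 1"
    by (metis (no_types, lifting) S_def mem_Collect_eq order_less_le)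
  then have "int p - 1 \<in> T p"
    using \<open>2 < p\<close> by (simp add: T_def)
  then show ?thesis
    by blast
qed

end
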